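(* Let $\mathcal L\ge 1$ and $M\ge 1$ be integers, let $\delta t>0$ and $T=M\,\delta t$, let $E\in\mathbb R$, let real constants $L_l<U_l$ for $0\le l\le \mathcal L$ be given, and let $\sigma\ge 1$ be given. Suppose that the uncertainty set $\hat{\boldsymbol\eta}_a\subset\mathbb R^{(\mathcal L+1)M}$ (defined in the context) has nonempty interior. Then the semi-infinite constraint $$\sum_{k=1}^M\sum_{l=0}^{\mathcal L} a_l^k (N^k)^l\,\delta t\le E\qquad \forall\, \hat{\boldsymbol a}=(a_l^k)\in\hat{\boldsymbol\eta}_a$$ on the vector $(N^k)_{1\le k\le M}$ of real numbers is equivalent to the following set of constraints: a vector $(N^k)_{1\le k\le M}$ satisfies the semi-infinite constraint if and only if there exist real numbers $\beta_l^k,\gamma_l^k$ ($1\le l\le\mathcal L$, $1\le k\le M$) and $\theta$ such that $$\sum_{l=1}^{\mathcal L}\sum_{k=1}^M \beta_l^k U_l-\sum_{l=1}^{\mathcal L}\sum_{k=1}^M\gamma_l^k L_l+\frac{M\sum_{l=1}^{\mathcal L}U_l}{\sigma}\,\theta+M U_0\,\delta t\le E,$$ $$\beta_l^k-\gamma_l^k+\theta=(N^k)^l\,\delta t\qquad \forall\, 1\le l\le\mathcal L,\ 1\le k\le M,$$ $$\beta_l^k\ge 0,\quad \gamma_l^k\ge 0,\quad \theta\ge 0\qquad \forall\, 1\le l\le\mathcal L,\ 1\le k\le M.$$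
   Context: $N^k$ is the (link) occupancy at the $k$-th of $M$ time steps of size $\delta t$, and $(N^k)^l$ denotes its $l$-th power, with $(N^k)^0=1$. The number $T=M\,\delta t$ is the length of the time horizon and $E$ is a prescribed bound. The uncertainty set is $$\hat{\boldsymbol\eta}_a=\Big\{\hat{\boldsymbol a}=(a_l^k)_{0\le l\le\mathcal L,\,1\le k\le M}:\ L_l\le a_l^k\le U_l\ \ \forall\,1\le k\le M,\ 0\le l\le\mathcal L;\ \ \sum_{k=1}^M\sum_{l=1}^{\mathcal L}a_l^k\,\delta t\le\frac{T\sum_{l=1}^{\mathcal L}U_l}{\sigma}\Big\},$$ viewed as a subset of $\mathbb R^{(\mathcal L+1)M}$. Note that the last (budget) constraint sums over $l\ge 1$ only. *)

theory Defs
  imports "HOL-Analysis.Analysis"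
begin

text \<open>
  Vectors \<open>(a_l^k)\<close> with \<open>0 \<le> l \<le> n\<close> and \<open>1 \<le> k \<le> M\<close> are extensional functions on the
  index set of pairs \<open>(l, k)\<close>. The space of all of them is the \<open>topspace\<close> of the finite
  product of \<open>(n + 1) * M\<close> copies of the real line, whose topology is the usual one.
\<close>

definition coeff_index :: "nat \<Rightarrow> nat \<Rightarrow> (nat \<times> nat) set" where
  "coeff_index n M = {0..n} \<times> {1..M}"

definition coeff_space :: "nat \<Rightarrow> nat \<Rightarrow> (nat \<times> nat \<Rightarrow> real) topology" where
  "coeff_space n M = product_topology (\<lambda>_. euclideanreal) (coeff_index n M)"

text \<open>The budget constraint deliberately omits the coefficients with \<open>l = 0\<close>.\<close>

definition uncertainty_set ::
  "nat \<Rightarrow> nat \<Rightarrow> real \<Rightarrow> real \<Rightarrow> real \<Rightarrow> (nat \<Rightarrow> real) \<Rightarrow> (nat \<Rightarrow> real) \<Rightarrow> (nat \<times> nat \<Rightarrow> real) set"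
  where
  "uncertainty_set n M \<delta>t T \<sigma> L U =
    {a \<in> topspace (coeff_space n M).
       (\<forall>k\<in>{1..M}. \<forall>l\<in>{0..n}. L l \<le> a (l, k) \<and> a (l, k) \<le> U l) \<and>
       (\<Sum>k=1..M. \<Sum>l=1..n. a (l, k) * \<delta>t) \<le> T * (\<Sum>l=1..n. U l) / \<sigma>}"

end

theory Submission
  imports Defs
begin

text \<open>
  The constraint says that a linear function of the coefficients stays below \<open>E\<close> on
  the uncertainty set, so the claim is linear programming duality for that set. The
  coefficients with \<open>l = 0\<close> are tied to nothing but their own bounds, and their weight \<open>\<delta>t\<close> is
  positive, so the worst case puts each of them at \<open>U 0\<close>; this is the term \<open>M U\<^sub>0 \<delta>t\<close>. After
  division of the budget by \<open>\<delta>t\<close>, the remaining coefficients range over a box cut by a single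
  budget constraint \<open>sum a I \<le> B\<close>. Maximizing a linear function there is the fractional
  knapsack problem.

  Weak duality (\<open>budgeted_box_weak_duality\<close>) is termwise. Strong duality does not need the
  general theory, because the knapsack problem is solved greedily: there is a threshold price
  \<open>\<theta> \<ge> 0\<close> such that items whose value exceeds \<open>\<theta>\<close> are taken up to their upper bound, items of
  lower value are kept at their lower bound, and items of value exactly \<open>\<theta>\<close> are taken in part so
  that the budget is used up, unless \<open>\<theta> = 0\<close>, in which case budget may be left over
  (\<open>greedy_knapsack_optimum\<close>). The positive and negative parts of the values reduced
  by \<open>\<theta>\<close> are then dual multipliers whose cost equals the value of this allocation, by
  complementary slackness. The dual optimum is therefore attained, and the two
  constraints are equivalent (\<open>budgeted_box_duality\<close>).

  Since the interior is nonempty, the uncertainty set has a point; hence the lower bounds alone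
  fit into the budget, and the knapsack problem is feasible.
\<close>

section \<open>A linear function on a box with one budget constraint\<close>

lemma budgeted_box_weak_duality:
  fixes a b c g l u :: "'i \<Rightarrow> real"
  assumes box: "\<And>i. i \<in> I \<Longrightarrow> l i \<le> a i \<and> a i \<le> u i"
    and budget: "sum a I \<le> B"
    and eq: "\<And>i. i \<in> I \<Longrightarrow> b i - g i + \<theta> = c i"
    and nonneg: "\<And>i. i \<in> I \<Longrightarrow> 0 \<le> b i \<and> 0 \<le> g i" and "0 \<le> \<theta>"
  shows "(\<Sum>i\<in>I. a i * c i) \<le> (\<Sum>i\<in>I. b i * u i) - (\<Sum>i\<in>I. g i * l i) + B * \<theta>"
proof -
  have "a i * c i \<le> b i * u i - g i * l i + a i * \<theta>" if i: "i \<in> I" for i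
  proof -
    have "b i * a i \<le> b i * u i" "g i * l i \<le> g i * a i"
      using box[OF i] nonneg[OF i] by (auto intro: mult_left_mono)
    then show ?thesis
      unfolding eq[OF i, symmetric] by (simp add: algebra_simps)
  qed
  then have "(\<Sum>i\<in>I. a i * c i) \<le> (\<Sum>i\<in>I. b i * u i - g i * l i + a i * \<theta>)"
    by (rule sum_mono)
  also have "\<dots> = (\<Sum>i\<in>I. b i * u i) - (\<Sum>i\<in>I. g i * l i) + sum a I * \<theta>"
    by (simp add: sum.distrib sum_subtractf sum_distrib_right)
  also have "sum a I * \<theta> \<le> B * \<theta>"
    using budget \<open>0 \<le> \<theta>\<close> by (rule mult_right_mono)
  finally show ?thesis by simp
qed

text \<open>
  The allocation that raises exactly the items of value above a threshold \<open>t\<close> to their upper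
  bounds changes only when \<open>t\<close> passes one of the finitely many values, so it suffices to try \<open>0\<close>
  and the positive values as thresholds. Let \<open>\<theta>\<close> be the least of them whose allocation fits into
  the budget; if \<open>\<theta> = 0\<close>, that allocation is optimal. If \<open>\<theta> > 0\<close>, the allocation at the preceding threshold exceeds the budget and differs from the one
  at \<open>\<theta>\<close> only in the items of value \<open>\<theta>\<close>; a convex combination of the two meets the budget.
\<close>

lemma greedy_knapsack_optimum:
  fixes c l u :: "'i \<Rightarrow> real"
  assumes "finite I" and lu: "\<forall>i\<in>I. l i \<le> u i" and "sum l I \<le> B"
  shows "\<exists>a \<theta>. (\<forall>i\<in>I. l i \<le> a i \<and> a i \<le> u i) \<and> sum a I \<le> B \<and> 0 \<le> \<theta> \<and>
    (\<forall>i\<in>I. (\<theta> < c i \<longrightarrow> a i = u i) \<and> (c i < \<theta> \<longrightarrow> a i = l i)) \<and> (0 < \<theta> \<longrightarrow> sum a I = B)"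
proof -
  define alloc where "alloc t i = (if t < c i then u i else l i)" for t i
  define C where "C = insert 0 {x \<in> c ` I. 0 < x}"
  define A where "A = {t \<in> C. sum (alloc t) I \<le> B}"
  have C: "finite C" "0 \<in> C" "\<And>t. t \<in> C \<Longrightarrow> 0 \<le> t"
    using \<open>finite I\<close> by (auto simp: C_def)
  have A: "finite A" using C by (simp add: A_def)
  have "c i \<le> Max C" if "i \<in> I" for i
  proof (cases "0 < c i")
    case True
    then show ?thesis using that C by (intro Max_ge) (auto simp: C_def)
  next
    case False
    moreover have "0 \<le> Max C" using C by (intro Max_ge)
    ultimately show ?thesis by simp
  qed
  \<comment> \<open>At the largest threshold every item stays at its lower bound, so some threshold fits.\<close>
  then have "sum (alloc (Max C)) I = sum l I"
    by (intro sum.cong) (simp_all add: alloc_def leD)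
  moreover have "Max C \<in> C" using C by (intro Max_in) auto
  ultimately have "Max C \<in> A" using \<open>sum l I \<le> B\<close> by (simp add: A_def)
  then have "A \<noteq> {}" by blast
  define \<theta> where "\<theta> = Min A"
  have "\<theta> \<in> A" unfolding \<theta>_def using A \<open>A \<noteq> {}\<close> by (rule Min_in)
  then have \<theta>: "\<theta> \<in> C" "sum (alloc \<theta>) I \<le> B" "0 \<le> \<theta>"
    using C by (auto simp: A_def)
  have box: "l i \<le> alloc t i \<and> alloc t i \<le> u i" if "i \<in> I" for t i
    using bspec[OF lu that] by (simp add: alloc_def)
  show ?thesis
  proof (cases "\<theta> = 0")
    case True
    have "\<forall>i\<in>I. (\<theta> < c i \<longrightarrow> alloc \<theta> i = u i) \<and> (c i < \<theta> \<longrightarrow> alloc \<theta> i = l i)"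
      by (simp add: alloc_def)
    then show ?thesis
      using \<theta> box[of _ \<theta>] True less_irrefl by blast
  next
    case False
    then have "0 < \<theta>" using \<theta> by simp
    define P where "P = {t \<in> C. t < \<theta>}"
    have P: "finite P" "0 \<in> P" using C \<open>0 < \<theta>\<close> by (auto simp: P_def)
    define \<theta>' where "\<theta>' = Max P"
    have "\<theta>' \<in> P" unfolding \<theta>'_def using P by (intro Max_in) auto
    then have \<theta>': "\<theta>' \<in> C" "\<theta>' < \<theta>" "0 \<le> \<theta>'" using C by (auto simp: P_def)
    have "\<theta>' \<notin> A" using \<theta>' Min_le[OF A, of \<theta>'] by (auto simp: \<theta>_def)
    then have over: "B < sum (alloc \<theta>') I" using \<theta>' by (simp add: A_def)
    \<comment> \<open>No value lies strictly between the two consecutive thresholds.\<close>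
    have gap: "c i \<le> \<theta>'" if "i \<in> I" "c i < \<theta>" for i
    proof (cases "0 < c i")
      case True
      then have "c i \<in> P" using that by (auto simp: P_def C_def)
      then show ?thesis unfolding \<theta>'_def using P by (intro Max_ge)
    next
      case False
      then show ?thesis using \<theta>' by simp
    qed
    define s where "s = (B - sum (alloc \<theta>) I) / (sum (alloc \<theta>') I - sum (alloc \<theta>) I)"
    have s: "0 \<le> s" "s \<le> 1" using over \<theta> by (auto simp: s_def)
    define a where "a i = alloc \<theta> i + s * (alloc \<theta>' i - alloc \<theta> i)" for i
    have "sum a I = sum (alloc \<theta>) I + s * (sum (alloc \<theta>') I - sum (alloc \<theta>) I)"
      by (simp add: a_def sum.distrib sum_subtractf sum_distrib_left[symmetric])
    also have "\<dots> = B" using over \<theta> by (simp add: s_def)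
    finally have sum_a: "sum a I = B" .
    have a_high: "a i = u i" if "\<theta> < c i" for i
      using that \<theta>' by (simp add: a_def alloc_def)
    have a_low: "a i = l i" if "i \<in> I" "c i < \<theta>" for i
      using gap[OF that] that by (simp add: a_def alloc_def)
    have a_box: "l i \<le> a i \<and> a i \<le> u i" if i: "i \<in> I" for i
    proof -
      have "a i = (1 - s) * alloc \<theta> i + s * alloc \<theta>' i"
        by (simp add: a_def algebra_simps)
      then show ?thesis
        using convexD_alt[of "{l i..u i}" "alloc \<theta> i" "alloc \<theta>' i" s] box[OF i] s by simp
    qed
    show ?thesis
      using a_box eq_refl[OF sum_a] sum_a \<open>0 \<le> \<theta>\<close> a_high a_low by blast
  qed
qed

text \<open>
  The constraint holds for all points as soon as it holds for the greedy allocation \<open>a\<close>. With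
  \<open>b\<close> and \<open>g\<close> the positive and negative parts of \<open>c - \<theta>\<close>, each product \<open>a i * (c i - \<theta>)\<close> equals
  \<open>b i * u i - g i * l i\<close>, and the budget left over by \<open>a\<close> has price \<open>0\<close>, so the bound for \<open>a\<close> is
  the dual bound.
\<close>

theorem budgeted_box_duality:
  fixes c l u :: "'i \<Rightarrow> real"
  assumes "finite I" and lu: "\<forall>i\<in>I. l i \<le> u i" and "sum l I \<le> B"
  shows "(\<forall>a. (\<forall>i\<in>I. l i \<le> a i \<and> a i \<le> u i) \<and> sum a I \<le> B \<longrightarrow> (\<Sum>i\<in>I. a i * c i) \<le> E)
     \<longleftrightarrow>
     (\<exists>b g \<theta>. (\<Sum>i\<in>I. b i * u i) - (\<Sum>i\<in>I. g i * l i) + B * \<theta> \<le> E \<and>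
        (\<forall>i\<in>I. b i - g i + \<theta> = c i) \<and> (\<forall>i\<in>I. 0 \<le> b i \<and> 0 \<le> g i) \<and> 0 \<le> \<theta>)"
    (is "?primal \<longleftrightarrow> ?dual")
proof
  assume ?primal
  obtain a \<theta> where box: "\<forall>i\<in>I. l i \<le> a i \<and> a i \<le> u i"
    and budget: "sum a I \<le> B" and "0 \<le> \<theta>"
    and extreme: "\<forall>i\<in>I. (\<theta> < c i \<longrightarrow> a i = u i) \<and> (c i < \<theta> \<longrightarrow> a i = l i)"
    and tight: "0 < \<theta> \<longrightarrow> sum a I = B"
    using greedy_knapsack_optimum[OF assms, where c = c]
    by (elim exE conjE)
  define b where "b i = max 0 (c i - \<theta>)" for i
  define g where "g i = max 0 (\<theta> - c i)" for i
  have "b i * u i - g i * l i = a i * c i - a i * \<theta>" if "i \<in> I" for i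
    using bspec[OF extreme that]
    by (cases "c i" \<theta> rule: linorder_cases) (simp_all add: b_def g_def algebra_simps)
  then have "(\<Sum>i\<in>I. b i * u i - g i * l i) = (\<Sum>i\<in>I. a i * c i - a i * \<theta>)"
    by (intro sum.cong) auto
  then have "(\<Sum>i\<in>I. b i * u i) - (\<Sum>i\<in>I. g i * l i) = (\<Sum>i\<in>I. a i * c i) - sum a I * \<theta>"
    by (simp add: sum_subtractf sum_distrib_right)
  moreover have "sum a I * \<theta> = B * \<theta>" using tight \<open>0 \<le> \<theta>\<close> by (cases "\<theta> = 0") auto
  moreover have "(\<Sum>i\<in>I. a i * c i) \<le> E" using \<open>?primal\<close> box budget by blast
  ultimately have "(\<Sum>i\<in>I. b i * u i) - (\<Sum>i\<in>I. g i * l i) + B * \<theta> \<le> E" by simp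
  moreover have "\<forall>i\<in>I. b i - g i + \<theta> = c i" "\<forall>i\<in>I. 0 \<le> b i \<and> 0 \<le> g i"
    by (auto simp: b_def g_def)
  ultimately show ?dual using \<open>0 \<le> \<theta>\<close> by blast
next
  assume ?dual
  then obtain b g \<theta> where "(\<Sum>i\<in>I. b i * u i) - (\<Sum>i\<in>I. g i * l i) + B * \<theta> \<le> E"
    and "\<And>i. i \<in> I \<Longrightarrow> b i - g i + \<theta> = c i"
    and "\<And>i. i \<in> I \<Longrightarrow> 0 \<le> b i \<and> 0 \<le> g i" and "0 \<le> \<theta>" by blast
  then have "(\<Sum>i\<in>I. a i * c i) \<le> E"
    if "\<forall>i\<in>I. l i \<le> a i \<and> a i \<le> u i" "sum a I \<le> B" for a
    using budgeted_box_weak_duality[of I l a u B b g \<theta> c] that by fastforce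
  then show ?primal by blast
qed

section \<open>The uncertainty set\<close>

lemma sum_by_time_eq_sum_pairs:
  fixes f :: "nat \<times> nat \<Rightarrow> real"
  shows "(\<Sum>k=1..M. \<Sum>l=1..n. f (l, k)) = sum f ({1..n} \<times> {1..M})"
  by (subst sum.swap) (simp add: sum.cartesian_product)

lemma sum_split_degree_0:
  fixes a :: "nat \<times> nat \<Rightarrow> real"
  shows "(\<Sum>k=1..M. \<Sum>l=0..n. a (l, k) * N k ^ l * d)
    = (\<Sum>k=1..M. a (0, k) * d) + (\<Sum>(l, k)\<in>{1..n} \<times> {1..M}. a (l, k) * (N k ^ l * d))"
proof -
  have "(\<Sum>k=1..M. \<Sum>l=0..n. a (l, k) * N k ^ l * d)
      = (\<Sum>k=1..M. a (0, k) * d + (\<Sum>l=1..n. a (l, k) * (N k ^ l * d)))"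
    by (simp add: sum.atLeast_Suc_atMost mult.assoc)
  then show ?thesis
    using sum_by_time_eq_sum_pairs[where f = "\<lambda>(l, k). a (l, k) * (N k ^ l * d)"]
    by (simp add: sum.distrib)
qed

lemma budget_rescale:
  fixes a :: "nat \<times> nat \<Rightarrow> real"
  assumes "0 < d"
  shows "(\<Sum>k=1..M. \<Sum>l=1..n. a (l, k) * d) \<le> real M * d * S / \<sigma>
    \<longleftrightarrow> sum a ({1..n} \<times> {1..M}) \<le> real M * S / \<sigma>"
proof -
  have "(\<Sum>k=1..M. \<Sum>l=1..n. a (l, k) * d) = d * sum a ({1..n} \<times> {1..M})"
    unfolding sum_by_time_eq_sum_pairs[symmetric] sum_distrib_left by (simp only: mult.commute)
  moreover have "real M * d * S / \<sigma> = d * (real M * S / \<sigma>)" by simp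
  ultimately show ?thesis using assms by (simp only: mult_le_cancel_left_pos)
qed

text \<open>
  In one direction a point of the budgeted box is completed by \<open>U 0\<close> in degree \<open>0\<close>, which the
  budget permits because it does not count degree \<open>0\<close>; in the other, this completion is the
  worst one.
\<close>

lemma robust_constraint_iff_budgeted_box:
  fixes n M :: nat and E \<sigma> d :: real and L U N :: "nat \<Rightarrow> real"
  assumes "0 < d" and "L 0 \<le> U 0"
  defines "I \<equiv> {1..n} \<times> {1..M}"
  shows "(\<forall>a \<in> uncertainty_set n M d (real M * d) \<sigma> L U.
            (\<Sum>k=1..M. \<Sum>l=0..n. a (l, k) * N k ^ l * d) \<le> E)
     \<longleftrightarrow>
     (\<forall>a. (\<forall>i\<in>I. L (fst i) \<le> a i \<and> a i \<le> U (fst i)) \<and> sum a I \<le> real M * (\<Sum>l=1..n. U l) / \<sigma>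
        \<longrightarrow> (\<Sum>i\<in>I. a i * (N (snd i) ^ fst i * d)) \<le> E - real M * U 0 * d)"
    (is "?robust \<longleftrightarrow> ?box")
proof
  assume robust: ?robust
  show ?box
  proof (intro allI impI)
    fix a :: "nat \<times> nat \<Rightarrow> real"
    assume a: "(\<forall>i\<in>I. L (fst i) \<le> a i \<and> a i \<le> U (fst i))
      \<and> sum a I \<le> real M * (\<Sum>l=1..n. U l) / \<sigma>"
    define a' where "a' = restrict (\<lambda>i. if fst i = 0 then U 0 else a i) (coeff_index n M)"
    have a'_0: "a' (0, k) = U 0" if "k \<in> {1..M}" for k
      using that by (simp add: a'_def coeff_index_def)
    have a'_I: "a' i = a i" if "i \<in> I" for i
      using that by (auto simp: a'_def coeff_index_def I_def)
    have "sum a' I = sum a I" using a'_I by (rule sum.cong[OF refl])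
    then have "(\<Sum>k=1..M. \<Sum>l=1..n. a' (l, k) * d) \<le> real M * d * (\<Sum>l=1..n. U l) / \<sigma>"
      using a budget_rescale[OF \<open>0 < d\<close>, where M = M and n = n and a = a'] by (simp add: I_def)
    moreover have "L l \<le> a' (l, k) \<and> a' (l, k) \<le> U l" if "k \<in> {1..M}" "l \<in> {0..n}" for k l
    proof (cases "l = 0")
      case True
      then show ?thesis using a'_0[OF that(1)] \<open>L 0 \<le> U 0\<close> by simp
    next
      case False
      then have "(l, k) \<in> I" using that by (simp add: I_def)
      then show ?thesis
      using bspec[OF conjunct1[OF a], of "(l, k)"] a'_I[of "(l, k)"] by simp
    qed
    moreover have "a' \<in> topspace (coeff_space n M)"
      by (simp add: a'_def coeff_space_def)
    ultimately have "a' \<in> uncertainty_set n M d (real M * d) \<sigma> L U"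
      by (simp add: uncertainty_set_def)
    then have "(\<Sum>k=1..M. \<Sum>l=0..n. a' (l, k) * N k ^ l * d) \<le> E" using robust by blast
    moreover have "(\<Sum>k=1..M. a' (0, k) * d) = real M * U 0 * d" using a'_0 by simp
    moreover have "(\<Sum>(l, k)\<in>I. a' (l, k) * (N k ^ l * d))
        = (\<Sum>i\<in>I. a i * (N (snd i) ^ fst i * d))"
      using a'_I by (intro sum.cong) auto
    ultimately show "(\<Sum>i\<in>I. a i * (N (snd i) ^ fst i * d)) \<le> E - real M * U 0 * d"
      unfolding sum_split_degree_0 I_def[symmetric] by linarith
  qed
next
  assume box: ?box
  show ?robust
  proof
    fix a assume a: "a \<in> uncertainty_set n M d (real M * d) \<sigma> L U"
    then have "\<forall>i\<in>I. L (fst i) \<le> a i \<and> a i \<le> U (fst i)"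
      by (auto simp: uncertainty_set_def I_def)
    moreover have "sum a I \<le> real M * (\<Sum>l=1..n. U l) / \<sigma>"
      using a budget_rescale[OF \<open>0 < d\<close>, where M = M and n = n and a = a] by (simp add: uncertainty_set_def I_def)
    ultimately have "(\<Sum>i\<in>I. a i * (N (snd i) ^ fst i * d)) \<le> E - real M * U 0 * d"
      using box by blast
    moreover have "(\<Sum>k=1..M. a (0, k) * d) \<le> (\<Sum>k=1..M. U 0 * d)"
      using a \<open>0 < d\<close> by (intro sum_mono mult_right_mono) (auto simp: uncertainty_set_def)
    ultimately show "(\<Sum>k=1..M. \<Sum>l=0..n. a (l, k) * N k ^ l * d) \<le> E"
      unfolding sum_split_degree_0 I_def[symmetric] by (simp add: case_prod_unfold)
  qed
qed

lemma ex_curry_pair: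
  fixes D :: "('a \<times> 'b \<Rightarrow> 'c) \<Rightarrow> ('a \<times> 'b \<Rightarrow> 'c) \<Rightarrow> 'd \<Rightarrow> bool"
  shows "(\<exists>b g \<theta>. D b g \<theta>) \<longleftrightarrow> (\<exists>\<beta> \<gamma> \<theta>. D (case_prod \<beta>) (case_prod \<gamma>) \<theta>)"
proof
  assume "\<exists>b g \<theta>. D b g \<theta>"
  then obtain b g \<theta> where "D b g \<theta>" by blast
  then have "D (case_prod (curry b)) (case_prod (curry g)) \<theta>" by simp
  then show "\<exists>\<beta> \<gamma> \<theta>. D (case_prod \<beta>) (case_prod \<gamma>) \<theta>" by blast
qed blast

theorem theorem4p2:
  fixes n M :: nat and \<delta>t T E \<sigma> :: real
    and L U :: "nat \<Rightarrow> real" and N :: "nat \<Rightarrow> real"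
  assumes "n \<ge> 1" and "M \<ge> 1" and "\<delta>t > 0" and "T = real M * \<delta>t"
    and "\<And>l. l \<le> n \<Longrightarrow> L l < U l"
    and "\<sigma> \<ge> 1"
    and "coeff_space n M interior_of uncertainty_set n M \<delta>t T \<sigma> L U \<noteq> {}"
  shows "(\<forall>a \<in> uncertainty_set n M \<delta>t T \<sigma> L U.
            (\<Sum>k=1..M. \<Sum>l=0..n. a (l, k) * N k ^ l * \<delta>t) \<le> E)
     \<longleftrightarrow>
     (\<exists>(\<beta> :: nat \<Rightarrow> nat \<Rightarrow> real) (\<gamma> :: nat \<Rightarrow> nat \<Rightarrow> real) (\<theta> :: real).
        (\<Sum>l=1..n. \<Sum>k=1..M. \<beta> l k * U l) - (\<Sum>l=1..n. \<Sum>k=1..M. \<gamma> l k * L l)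
          + real M * (\<Sum>l=1..n. U l) / \<sigma> * \<theta> + real M * U 0 * \<delta>t \<le> E \<and>
        (\<forall>l\<in>{1..n}. \<forall>k\<in>{1..M}. \<beta> l k - \<gamma> l k + \<theta> = N k ^ l * \<delta>t) \<and>
        (\<forall>l\<in>{1..n}. \<forall>k\<in>{1..M}. \<beta> l k \<ge> 0 \<and> \<gamma> l k \<ge> 0) \<and> \<theta> \<ge> 0)"
proof -
  define I where "I = {1..n} \<times> {1..M}"
  define B where "B = real M * (\<Sum>l=1..n. U l) / \<sigma>"
  have LU: "\<forall>i\<in>I. L (fst i) \<le> U (fst i)"
    using less_imp_le[OF assms(5)] by (auto simp: I_def)
  obtain a where a: "a \<in> uncertainty_set n M \<delta>t T \<sigma> L U"
    using assms(7) interior_of_subset by fastforce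
  have "(\<Sum>i\<in>I. L (fst i)) \<le> sum a I"
    using a by (intro sum_mono) (auto simp: uncertainty_set_def I_def)
  also have "sum a I \<le> B"
    using a budget_rescale[OF \<open>\<delta>t > 0\<close>, where M = M and n = n and a = a] \<open>T = real M * \<delta>t\<close>
    by (simp add: uncertainty_set_def I_def B_def)
  finally have lower: "(\<Sum>i\<in>I. L (fst i)) \<le> B" .
  have "finite I" by (simp add: I_def)
  have "(\<forall>a \<in> uncertainty_set n M \<delta>t T \<sigma> L U.
            (\<Sum>k=1..M. \<Sum>l=0..n. a (l, k) * N k ^ l * \<delta>t) \<le> E)
    \<longleftrightarrow> (\<forall>a. (\<forall>i\<in>I. L (fst i) \<le> a i \<and> a i \<le> U (fst i)) \<and> sum a I \<le> B
        \<longrightarrow> (\<Sum>i\<in>I. a i * (N (snd i) ^ fst i * \<delta>t)) \<le> E - real M * U 0 * \<delta>t)"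
    using robust_constraint_iff_budgeted_box[of \<delta>t L U n M \<sigma> N E] assms(3) assms(4)
      less_imp_le[OF assms(5)[of 0]]
    by (simp add: I_def B_def)
  also have "\<dots> \<longleftrightarrow> (\<exists>b g \<theta>. (\<Sum>i\<in>I. b i * U (fst i)) - (\<Sum>i\<in>I. g i * L (fst i)) + B * \<theta>
          \<le> E - real M * U 0 * \<delta>t \<and>
        (\<forall>i\<in>I. b i - g i + \<theta> = N (snd i) ^ fst i * \<delta>t) \<and> (\<forall>i\<in>I. 0 \<le> b i \<and> 0 \<le> g i) \<and> 0 \<le> \<theta>)"
    (is "_ \<longleftrightarrow> (\<exists>b g \<theta>. ?dual b g \<theta>)")
    by (rule budgeted_box_duality[OF \<open>finite I\<close> LU lower])
  also have "\<dots> \<longleftrightarrow> (\<exists>\<beta> \<gamma> \<theta>. ?dual (case_prod \<beta>) (case_prod \<gamma>) \<theta>)"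
    by (rule ex_curry_pair)
  also have "\<dots> \<longleftrightarrow> (\<exists>(\<beta> :: nat \<Rightarrow> nat \<Rightarrow> real) (\<gamma> :: nat \<Rightarrow> nat \<Rightarrow> real) (\<theta> :: real).
        (\<Sum>l=1..n. \<Sum>k=1..M. \<beta> l k * U l) - (\<Sum>l=1..n. \<Sum>k=1..M. \<gamma> l k * L l)
          + real M * (\<Sum>l=1..n. U l) / \<sigma> * \<theta> + real M * U 0 * \<delta>t \<le> E \<and>
        (\<forall>l\<in>{1..n}. \<forall>k\<in>{1..M}. \<beta> l k - \<gamma> l k + \<theta> = N k ^ l * \<delta>t) \<and>
        (\<forall>l\<in>{1..n}. \<forall>k\<in>{1..M}. \<beta> l k \<ge> 0 \<and> \<gamma> l k \<ge> 0) \<and> \<theta> \<ge> 0)"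
    unfolding I_def B_def sum.cartesian_product case_prod_unfold le_diff_eq
    by (simp only: split_paired_Ball_Sigma fst_conv snd_conv)
  finally show ?thesis .
qed

end
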